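(* For $k\in\mathcal{I}$ let $m_k=(k^2-1)/3$ and $n_k=m_k+2k+2$. Then $$\bigcup_{k\in\mathcal{I}}\{m_k,\dots,n_k\}=\bigcup_{k=1+3j,\ j\ge0}\{m_k,\dots,n_k\}=\mathbb{N}_{\ge0}$$ and $$\bigcup_{k\in\mathcal{I},\ k>1}\{m_k,\dots,n_k\}=\bigcup_{k=2+3j,\ j\ge0}\{m_k,\dots,n_k\}=\mathbb{N}_{\ge1}.$$
   Context: $\mathcal{I}=\mathbb{N}_{\ge1}\setminus3\mathbb{N}_{\ge1}=\{1,2,4,5,7,8,\dots\}$ is the set of positive integers that are not multiples of three. $\mathbb{N}_{\ge0}$ and $\mathbb{N}_{\ge1}$ are the nonnegative and positive integers. $\{m,\dots,n\}$ denotes the set of consecutive integers from $m$ to $n$. The sets $\{m_k,\dots,n_k\}$, $k\in\mathcal{I}$, are the supports of the orthogonal dice (discrete uniform distributions on consecutive nonnegative integers whose mean equals their variance). *)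

theory Defs
  imports Main
begin

definition dice_index :: "nat set" where
  "dice_index = {1..} - (\<lambda>j. 3 * j) ` {1..}"

text \<open>The truncating operations below are exact on the index set, where \<open>k \<ge> 1\<close> and \<open>3\<close> divides
  \<open>k\<^sup>2 - 1\<close>; see \<open>three_times_die_min\<close>.\<close>

definition die_min :: "nat \<Rightarrow> nat" where
  "die_min k = (k\<^sup>2 - 1) div 3"

definition die_max :: "nat \<Rightarrow> nat" where
  "die_max k = die_min k + 2 * k + 2"

lemma three_times_die_min:
  assumes "k \<in> dice_index"
  shows "3 * int (die_min k) = (int k)\<^sup>2 - 1"
proof -
  have nm: "k \<noteq> 3 * j" if "j \<ge> 1" for j
    using assms that by (auto simp: dice_index_def)
  have k: "k \<ge> 1" using assms by (simp add: dice_index_def)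
  have "k mod 3 \<noteq> 0"
  proof
    assume "k mod 3 = 0"
    then have "k = 3 * (k div 3)" and "k div 3 \<ge> 1" using k by presburger+
    with nm show False by blast
  qed
  then have "k mod 3 = 1 \<or> k mod 3 = 2" by presburger
  then have "k\<^sup>2 mod 3 = 1"
    by (auto simp: power2_eq_square mod_mult_eq [of k 3 k, symmetric])
  then have "3 dvd k\<^sup>2 - 1" by presburger
  then have "3 * die_min k = k\<^sup>2 - 1" by (simp add: die_min_def)
  then have "int (3 * die_min k) = int (k\<^sup>2 - 1)" by simp
  also have "\<dots> = (int k)\<^sup>2 - 1" using k by (simp add: of_nat_diff)
  finally show ?thesis by simp
qed

end

theory Submission
  imports Defs
begin

text \<open>Adding \<open>3\<close> to \<open>k\<close> raises \<open>(k\<^sup>2 - 1) / 3\<close> by exactly \<open>2 * k + 3\<close>, so the support for \<open>k + 3\<close>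
  begins one above the end of the support for \<open>k\<close> (\<open>die_min_add_3\<close>). Along a residue class modulo
  \<open>3\<close> the supports therefore tile a half-line, with neither gaps nor overlaps, starting at the
  minimum of the first support (\<open>UN_die_supports_step_3\<close>). For the classes of \<open>1\<close> and \<open>2\<close> these
  starting points are \<open>0\<close> and \<open>1\<close>. The full unions add nothing: they contain one of these two tilings,
  and a support with \<open>k > 1\<close> cannot reach \<open>0\<close> because its minimum is at least \<open>(2\<^sup>2 - 1) / 3 = 1\<close>.\<close>

lemma UN_abutting_intervals:
  fixes a b :: "nat \<Rightarrow> nat"
  assumes le: "\<And>j. a j \<le> b j" and abut: "\<And>j. a (Suc j) = Suc (b j)"
  shows "(\<Union>j. {a j..b j}) = {a 0..}"
proof (intro equalityI subsetI)
  fix x assume "x \<in> (\<Union>j. {a j..b j})"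
  then obtain j where "a j \<le> x" by auto
  moreover have "a 0 \<le> a j"
    by (rule lift_Suc_mono_le[of a]) (simp_all add: abut le le_SucI)
  ultimately show "x \<in> {a 0..}" by simp
next
  fix x assume "x \<in> {a 0..}"
  then have "a 0 \<le> x" by simp
  then show "x \<in> (\<Union>j. {a j..b j})"
  proof (induction x rule: dec_induct)
    case base
    show ?case using le by auto
  next
    case (step x)
    then obtain j where "a j \<le> x" "x \<le> b j" by auto
    \<comment> \<open>Either \<open>x + 1\<close> stays in the interval of \<open>x\<close>, or \<open>x\<close> is its right end and \<open>x + 1\<close> opens the
      next interval.\<close>
    then have "Suc x \<in> {a j..b j} \<or> Suc x \<in> {a (Suc j)..b (Suc j)}"
      using le[of "Suc j"] abut[of j] by auto
    then show ?case by blast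
  qed
qed

text \<open>Since \<open>(k + 3)\<^sup>2 - 1 = (k\<^sup>2 - 1) + 3 * (2 * k + 3)\<close>, rounding in the division by \<open>3\<close> affects both
  minima equally. For \<open>k = 0\<close> the truncated \<open>0 - 1\<close> would break this equation.\<close>

lemma die_min_add_3:
  assumes "k \<ge> 1"
  shows "die_min (k + 3) = Suc (die_max k)"
proof -
  have "k\<^sup>2 \<ge> 1" using assms by simp
  then have "(k + 3)\<^sup>2 - 1 = (k\<^sup>2 - 1) + 3 * (2 * k + 3)"
    by (simp add: power2_eq_square algebra_simps)
  then show ?thesis by (simp add: die_min_def die_max_def)
qed

lemma UN_die_supports_step_3:
  assumes "r \<ge> 1"
  shows "(\<Union>k\<in>{r + 3 * j | j. j \<ge> 0}. {die_min k..die_max k}) = {die_min r..}"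
proof -
  have "(\<Union>k\<in>{r + 3 * j | j. j \<ge> 0}. {die_min k..die_max k})
      = (\<Union>j. {die_min (r + 3 * j)..die_max (r + 3 * j)})"
    by auto
  also have "\<dots> = {die_min (r + 3 * 0)..}"
  proof (rule UN_abutting_intervals)
    show "die_min (r + 3 * j) \<le> die_max (r + 3 * j)" for j
      by (simp add: die_max_def)
    show "die_min (r + 3 * Suc j) = Suc (die_max (r + 3 * j))" for j
      using die_min_add_3[of "r + 3 * j"] assms by (simp add: algebra_simps)
  qed
  finally show ?thesis by simp
qed

lemma die_min_pos:
  assumes "k > 1"
  shows "die_min k \<ge> 1"
proof -
  have "2\<^sup>2 \<le> k\<^sup>2" using assms by (intro power_mono) auto
  then have "3 \<le> k\<^sup>2 - 1" by simp
  then show ?thesis by (simp add: die_min_def)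
qed

lemma dice_index_residues:
  "{1 + 3 * j | j. j \<ge> 0} \<subseteq> dice_index"
  "{2 + 3 * j | j. j \<ge> 0} \<subseteq> {k \<in> dice_index. k > 1}"
  unfolding dice_index_def by (auto, presburger+)

theorem corollary3p1:
  shows "(\<Union>k\<in>dice_index. {die_min k..die_max k}) = (\<Union>k\<in>{1 + 3 * j | j. j \<ge> 0}. {die_min k..die_max k}) \<and>
    (\<Union>k\<in>{1 + 3 * j | j. j \<ge> 0}. {die_min k..die_max k}) = (UNIV :: nat set) \<and>
    (\<Union>k\<in>{k \<in> dice_index. k > 1}. {die_min k..die_max k}) = (\<Union>k\<in>{2 + 3 * j | j. j \<ge> 0}. {die_min k..die_max k}) \<and>
    (\<Union>k\<in>{2 + 3 * j | j. j \<ge> 0}. {die_min k..die_max k}) = {1::nat..}"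
proof -
  let ?U = "\<lambda>K. \<Union>k\<in>K. {die_min k..die_max k}"
  have class1: "?U {1 + 3 * j | j. j \<ge> 0} = UNIV"
    using UN_die_supports_step_3[of 1] by (simp add: die_min_def atLeast_0)
  have class2: "?U {2 + 3 * j | j. j \<ge> 0} = {1..}"
    using UN_die_supports_step_3[of 2] by (simp add: die_min_def)
  have "?U {1 + 3 * j | j. j \<ge> 0} \<subseteq> ?U dice_index"
    by (rule UN_mono[OF dice_index_residues(1) order_refl])
  then have all: "?U dice_index = UNIV"
    using class1 by auto
  have "?U {2 + 3 * j | j. j \<ge> 0} \<subseteq> ?U {k \<in> dice_index. k > 1}"
    by (rule UN_mono[OF dice_index_residues(2) order_refl])
  moreover have "?U {k \<in> dice_index. k > 1} \<subseteq> {1..}"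
    using die_min_pos by fastforce
  ultimately have "?U {k \<in> dice_index. k > 1} = {1..}"
    using class2 by auto
  with all class1 class2 show ?thesis by simp
qed

end
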